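(* Let $r\ge 1$ be an integer and let $\mathbf z=(z_1,\dots,z_r)\in(\mathbb C^\times)^r$. (1) For $n=0,1,\dots,2r$, $$e^{(2r)}_n(\mathbf z,\mathbf z^{-1})=\sum_{k=\max\{\lfloor (n-r)/2\rfloor,\,0\}}^{\lfloor n/2\rfloor}\binom{r-n+2k}{k}\,e^{(r)}_{n-2k}(\mathbf z+\mathbf z^{-1}).$$ (2) For every non-negative integer $n$, $$h^{(2r)}_n(\mathbf z,\mathbf z^{-1})=\sum_{k=0}^{\lfloor n/2\rfloor}(-1)^k\binom{n-k+r-1}{k}\,h^{(r)}_{n-2k}(\mathbf z+\mathbf z^{-1}).$$ (3) For every positive integer $n$, $$p^{(2r)}_n(\mathbf z,\mathbf z^{-1})=2\sum_{k=0}^{\lfloor (n+1)/2\rfloor}\binom{2k-n-1}{k}\,p^{(r)}_{n-2k}(\mathbf z+\mathbf z^{-1})-\sum_{k=0}^{\lfloor n/2\rfloor}\binom{2k-n}{k}\,p^{(r)}_{n-2k}(\mathbf z+\mathbf z^{-1}),$$ where, for odd $n$, the term $k=(n+1)/2$ of the first sum (which has coefficient $\binom{0}{k}=0$) is read as $0$.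
   Context: For $s\ge1$, $n\ge0$ and $\mathbf w=(w_1,\dots,w_s)\in\mathbb C^s$: $e^{(s)}_n(\mathbf w)=\sum_{1\le j_1<\dots<j_n\le s}w_{j_1}\cdots w_{j_n}$ for $1\le n\le s$, $e_0^{(s)}=1$, $e^{(s)}_n=0$ for $n>s$ (elementary symmetric); $h^{(s)}_n(\mathbf w)=\sum_{m_1+\dots+m_s=n}w_1^{m_1}\cdots w_s^{m_s}$ over non-negative integers $m_i$ (complete homogeneous); $p^{(s)}_n(\mathbf w)=\sum_{j=1}^s w_j^n$ (power sum, so $p_0^{(s)}=s$). For $\mathbf z\in(\mathbb C^\times)^r$: $\mathbf z+\mathbf z^{-1}:=(z_1+z_1^{-1},\dots,z_r+z_r^{-1})\in\mathbb C^r$ and $(\mathbf z,\mathbf z^{-1}):=(z_1,\dots,z_r,z_1^{-1},\dots,z_r^{-1})\in\mathbb C^{2r}$. For an integer $n$ (possibly negative), $\binom nk=\frac{n(n-1)\cdots(n-k+1)}{k!}$ for $k\ge1$ and $\binom n0=1$. $\lfloor x\rfloor$ is the greatest integer not exceeding $x$. *)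

theory Defs
  imports Complex_Main
begin

text \<open>
  A vector \<open>w \<in> \<complex>\<^sup>s\<close> is a list of length \<open>s\<close>, so the number of variables is always
  \<open>length w\<close>, and concatenation of vectors is \<open>(@)\<close>.
\<close>

text \<open>
  Index tuples \<open>j\<^sub>1 < \<dots> < j\<^sub>n\<close> are identified with \<open>n\<close>-element sets of (0-based) indices.
\<close>

definition elem_sym :: "nat \<Rightarrow> complex list \<Rightarrow> complex" where
  "elem_sym n w = (\<Sum>J | J \<subseteq> {..<length w} \<and> card J = n. \<Prod>j\<in>J. w ! j)"

definition complete_sym :: "nat \<Rightarrow> complex list \<Rightarrow> complex" where
  "complete_sym n w =
     (\<Sum>m | length m = length w \<and> sum_list m = n. \<Prod>i<length w. w ! i ^ (m ! i))"

definition power_sym :: "nat \<Rightarrow> complex list \<Rightarrow> complex" where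
  "power_sym n w = (\<Sum>j<length w. w ! j ^ n)"

definition plus_inverse :: "complex list \<Rightarrow> complex list" where
  "plus_inverse z = map (\<lambda>x. x + inverse x) z"

definition with_inverse :: "complex list \<Rightarrow> complex list" where
  "with_inverse z = z @ map inverse z"

text \<open>
  Binomial coefficients with a possibly negative integer upper argument; the value is taken in
  \<open>\<complex>\<close>, where \<open>gchoose\<close> is a product divided by a factorial.
\<close>

definition ibinom :: "int \<Rightarrow> nat \<Rightarrow> complex" where
  "ibinom a k = of_int a gchoose k"

lemma ibinom_altdef: "ibinom a k = (\<Prod>i<k. of_int a - of_nat i) / fact k"
  by (simp add: ibinom_def gbinomial_prod_rev atLeast0LessThan)

lemma elem_sym_0: "elem_sym 0 w = 1"
proof -
  have "{J. J \<subseteq> {..<length w} \<and> card J = 0} = {{}}"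
    by (auto dest: finite_subset)
  then show ?thesis
    by (simp add: elem_sym_def)
qed

lemma elem_sym_eq_0:
  assumes "length w < n"
  shows "elem_sym n w = 0"
proof -
  have "card J \<le> length w" if "J \<subseteq> {..<length w}" for J
    using card_mono[OF _ that] by simp
  then have none: "{J. J \<subseteq> {..<length w} \<and> card J = n} = {}"
    using assms leD by blast
  show ?thesis
    unfolding elem_sym_def none by (rule sum.empty)
qed

text \<open>The sum defining \<open>complete_sym\<close> is finite, so it is never 0 by convention.\<close>

lemma finite_exponents: "finite {m :: nat list. length m = s \<and> sum_list m = n}"
proof (rule finite_subset)
  show "{m :: nat list. length m = s \<and> sum_list m = n} \<subseteq> {m. set m \<subseteq> {..n} \<and> length m = s}"
    by (auto intro: member_le_sum_list)
  show "finite {m :: nat list. set m \<subseteq> {..n} \<and> length m = s}"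
    by (rule finite_lists_length_eq) simp
qed

lemma power_sym_0: "power_sym 0 w = of_nat (length w)"
  by (simp add: power_sym_def)

end

theory Submission
  imports Defs "HOL-Computational_Algebra.Formal_Power_Series"
begin

text \<open>
  The three generating functions of a vector \<open>w\<close> are
  \<open>E\<^sub>w = \<Prod>(1 + w\<^sub>i X)\<close>, \<open>H\<^sub>w = \<Prod>(1 - w\<^sub>i X)\<^sup>-\<^sup>1\<close> and \<open>P\<^sub>w = \<Sum>(1 - w\<^sub>i X)\<^sup>-\<^sup>1\<close>.
  Pairing the factors of \<open>x\<close> and \<open>x\<^sup>-\<^sup>1\<close> gives, with the substitution \<open>Y = X / (1 + X\<^sup>2)\<close>,
  \<open>(1 - x X) (1 - x\<^sup>-\<^sup>1 X) = 1 - (x + x\<^sup>-\<^sup>1) X + X\<^sup>2 = (1 + X\<^sup>2) (1 - (x + x\<^sup>-\<^sup>1) Y)\<close>,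
  and likewise with plus signs. Consequently, if \<open>u\<close> is \<open>(z, z\<^sup>-\<^sup>1)\<close>, \<open>w\<close> is \<open>z + z\<^sup>-\<^sup>1\<close>
  and \<open>r\<close> is the length of \<open>z\<close>:

  \<^item> \<open>E\<^sub>u = (1 + X\<^sup>2)\<^sup>r \<cdot> E\<^sub>w(Y)\<close>,
  \<^item> \<open>H\<^sub>u = (1 + X\<^sup>2)\<^sup>-\<^sup>r \<cdot> H\<^sub>w(Y)\<close>,
  \<^item> \<open>P\<^sub>u = 2 (1 + X\<^sup>2)\<^sup>-\<^sup>1 \<cdot> P\<^sub>w(Y) - P\<^sub>w(Y) + r\<close>.

  All three right-hand sides are built from series \<open>(1 + X\<^sup>2)\<^sup>a \<cdot> F(Y)\<close>. Since
  \<open>Y\<^sup>m = X\<^sup>m (1 + X\<^sup>2)\<^sup>-\<^sup>m\<close>, the binomial series yields its \<open>n\<close>-th coefficient as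
  \<open>\<Sum>\<^sub>k (a - (n - 2k) choose k) F\<^sub>n\<^sub>-\<^sub>2\<^sub>k\<close> (lemma \<open>fps_nth_substitution\<close>), and the
  three formulas are this expansion for \<open>a = r\<close>, for \<open>a = -r\<close>, and for \<open>a = -1\<close> together
  with \<open>a = 0\<close>. The negative upper arguments in the third formula come from
  these negative exponents of \<open>1 + X\<^sup>2\<close>.
\<close>

unbundle fps_syntax

section \<open>Powers of 1 + X^2 and the substitution X / (1 + X^2)\<close>

definition one_plus_X2_powr :: "complex \<Rightarrow> complex fps" where
  "one_plus_X2_powr a = fps_binomial a oo fps_X ^ 2"

definition X_over_one_plus_X2 :: "complex fps" where
  "X_over_one_plus_X2 = fps_X * one_plus_X2_powr (-1)"

lemma X_over_one_plus_X2_nth_0 [simp]: "X_over_one_plus_X2 $ 0 = 0"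
  by (simp add: X_over_one_plus_X2_def)

lemma one_plus_X2_powr_add:
  "one_plus_X2_powr (a + b) = one_plus_X2_powr a * one_plus_X2_powr b"
  by (simp add: one_plus_X2_powr_def fps_binomial_add_mult fps_compose_mult_distrib)

lemma one_plus_X2_powr_0 [simp]: "one_plus_X2_powr 0 = 1"
  by (simp add: one_plus_X2_powr_def)

lemma one_plus_X2_powr_1: "one_plus_X2_powr 1 = 1 + fps_X ^ 2"
  by (simp add: one_plus_X2_powr_def fps_binomial_1 fps_compose_add_distrib)

lemma one_plus_X2_powr_minus: "inverse (one_plus_X2_powr a) = one_plus_X2_powr (- a)"
  by (rule fps_inverse_unique) (simp add: one_plus_X2_powr_add [symmetric])

lemma one_plus_X2_powr_nth:
  "one_plus_X2_powr a $ n = (if even n then a gchoose (n div 2) else 0)"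
proof -
  have "one_plus_X2_powr a $ n = (\<Sum>i=0..n. (a gchoose i) * (if n = 2 * i then 1 else 0))"
    by (simp add: one_plus_X2_powr_def fps_compose_nth power_mult [symmetric] fps_X_power_nth)
  also have "\<dots> = (\<Sum>i=0..n. if i = n div 2 then if even n then a gchoose i else 0 else 0)"
    by (rule sum.cong) auto
  also have "\<dots> = (if even n then a gchoose (n div 2) else 0)"
    by simp
  finally show ?thesis .
qed

lemma X_over_one_plus_X2_power:
  "X_over_one_plus_X2 ^ m = fps_X ^ m * one_plus_X2_powr (- of_nat m)"
proof -
  have "one_plus_X2_powr (-1) ^ m = one_plus_X2_powr (- of_nat m)"
    by (induction m) (simp_all add: one_plus_X2_powr_add [symmetric] algebra_simps)
  then show ?thesis
    by (simp add: X_over_one_plus_X2_def power_mult_distrib)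
qed

text \<open>
  Because \<open>Y\<close> has no constant term, \<open>Y\<^sup>i\<close> does not contribute to coefficients below the
  \<open>i\<close>-th, so the composition may be summed up to the fixed bound \<open>n\<close> and multiplied
  by \<open>A\<close> term by term.
\<close>

lemma fps_nth_mult_compose:
  fixes A F Y :: "'a::comm_ring_1 fps"
  assumes "Y $ 0 = 0"
  shows "(A * (F oo Y)) $ n = (\<Sum>i=0..n. F $ i * (A * Y ^ i) $ n)"
proof -
  have comp: "(F oo Y) $ j = (\<Sum>i=0..n. F $ i * Y ^ i $ j)" if "j \<le> n" for j
    unfolding fps_compose_nth
    by (rule sum.mono_neutral_left)
      (use that startsby_zero_power_prefix [OF assms] in auto)
  have "(A * (F oo Y)) $ n = (\<Sum>j=0..n. \<Sum>i=0..n. A $ j * (F $ i * Y ^ i $ (n - j)))"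
    by (simp add: fps_mult_nth comp sum_distrib_left)
  also have "\<dots> = (\<Sum>i=0..n. \<Sum>j=0..n. A $ j * (F $ i * Y ^ i $ (n - j)))"
    by (rule sum.swap)
  also have "\<dots> = (\<Sum>i=0..n. F $ i * (A * Y ^ i) $ n)"
    by (simp add: fps_mult_nth sum_distrib_left mult_ac)
  finally show ?thesis .
qed

text \<open>
  The \<open>i\<close>-th term of the composition is \<open>F\<^sub>i X\<^sup>i (1 + X\<^sup>2)\<^sup>a\<^sup>-\<^sup>i\<close>; it reaches the
  exponent \<open>n\<close> only for \<open>i = n - 2 k\<close>, through the \<open>k\<close>-th binomial coefficient.
\<close>

lemma fps_nth_substitution:
  "(one_plus_X2_powr (of_int a) * (F oo X_over_one_plus_X2)) $ n =
     (\<Sum>k=0..n div 2. ibinom (a - int n + 2 * int k) k * F $ (n - 2 * k))"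
proof -
  have coeff: "(one_plus_X2_powr (of_int a) * X_over_one_plus_X2 ^ i) $ n =
      (if even (n - i) then ibinom (a - int i) ((n - i) div 2) else 0)" if "i \<le> n" for i
  proof -
    have "one_plus_X2_powr (of_int a) * X_over_one_plus_X2 ^ i =
        fps_X ^ i * one_plus_X2_powr (of_int a + - of_nat i)"
      unfolding X_over_one_plus_X2_power one_plus_X2_powr_add by (simp add: mult_ac)
    then show ?thesis
      using that by (simp add: fps_X_power_mult_nth one_plus_X2_powr_nth ibinom_def)
  qed
  have "(one_plus_X2_powr (of_int a) * (F oo X_over_one_plus_X2)) $ n =
      (\<Sum>i=0..n. F $ i *
        (if even (n - i) then ibinom (a - int i) ((n - i) div 2) else 0))"
    by (simp add: fps_nth_mult_compose coeff)
  also have "\<dots> = (\<Sum>i | i \<le> n \<and> even (n - i). F $ i * ibinom (a - int i) ((n - i) div 2))"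
    by (rule sum.mono_neutral_cong_right) auto
  also have "\<dots> = (\<Sum>k=0..n div 2. ibinom (a - int n + 2 * int k) k * F $ (n - 2 * k))"
  proof (rule sum.reindex_bij_witness
      [where i = "\<lambda>k. n - 2 * k" and j = "\<lambda>i. (n - i) div 2"])
    fix i
    assume i: "i \<in> {i. i \<le> n \<and> even (n - i)}"
    then show "n - 2 * ((n - i) div 2) = i" "(n - i) div 2 \<in> {0..n div 2}"
      by auto
    moreover from i have "a - int n + 2 * int ((n - i) div 2) = a - int i"
      by (simp, presburger)
    ultimately show "ibinom (a - int n + 2 * int ((n - i) div 2)) ((n - i) div 2) *
        F $ (n - 2 * ((n - i) div 2)) = F $ i * ibinom (a - int i) ((n - i) div 2)"
      by (simp only: mult.commute [of "F $ i"])
  qed auto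
  finally show ?thesis .
qed

section \<open>Generating functions of the symmetric functions\<close>

text \<open>
  The sign \<open>c\<close> is \<open>1\<close> for the generating function of the elementary symmetric functions
  and \<open>-1\<close> for the reciprocal of that of the complete homogeneous ones.
\<close>

definition linear_factors :: "complex \<Rightarrow> complex list \<Rightarrow> complex fps" where
  "linear_factors c w = (\<Prod>x\<leftarrow>w. 1 + fps_const (c * x) * fps_X)"

lemma linear_factors_Nil [simp]: "linear_factors c [] = 1"
  by (simp add: linear_factors_def)

lemma linear_factors_Cons [simp]:
  "linear_factors c (x # w) = (1 + fps_const (c * x) * fps_X) * linear_factors c w"
  by (simp add: linear_factors_def)

lemma linear_factors_append:
  "linear_factors c (v @ w) = linear_factors c v * linear_factors c w"
  by (simp add: linear_factors_def)

lemma linear_factors_nth_0 [simp]: "linear_factors c w $ 0 = 1"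
  by (induction w) simp_all

text \<open>
  Expanding the product chooses in each factor either the linear term or \<open>1\<close>; the set
  of positions where the linear term is chosen is the index set \<open>J\<close>.
\<close>

lemma elem_sym_generating_function: "Abs_fps (\<lambda>n. elem_sym n w) = linear_factors 1 w"
proof (rule fps_ext)
  fix n
  have prod_monomial: "(\<Prod>j\<in>J. fps_const (w ! j) * fps_X) =
      fps_const (\<Prod>j\<in>J. w ! j) * fps_X ^ card J" if "finite J" for J
    using that by (induction J) (simp_all add: mult_ac flip: fps_const_mult)
  have "linear_factors 1 w = (\<Prod>j<length w. fps_const (w ! j) * fps_X + 1)"
    by (simp add: linear_factors_def prod.list_conv_set_nth atLeast0LessThan add.commute)
  also have "\<dots> = (\<Sum>J\<in>Pow {..<length w}. \<Prod>j\<in>J. fps_const (w ! j) * fps_X)"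
    by (subst prod_add) simp_all
  also have "\<dots> = (\<Sum>J\<in>Pow {..<length w}. fps_const (\<Prod>j\<in>J. w ! j) * fps_X ^ card J)"
    by (intro sum.cong refl prod_monomial) (auto intro: finite_subset)
  finally have "linear_factors 1 w $ n =
      (\<Sum>J\<in>Pow {..<length w}. if card J = n then \<Prod>j\<in>J. w ! j else 0)"
    by (simp add: fps_sum_nth fps_X_power_nth if_distrib eq_commute [of n] cong: if_cong)
  also have "\<dots> = elem_sym n w"
    unfolding elem_sym_def by (rule sum.mono_neutral_cong_right) auto
  finally show "Abs_fps (\<lambda>n. elem_sym n w) $ n = linear_factors 1 w $ n"
    by simp
qed

lemma geometric_fps: "Abs_fps (\<lambda>n. x ^ n) = inverse (1 - fps_const x * fps_X)"
  for x :: complex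
proof (rule fps_inverse_unique [symmetric], rule fps_ext)
  fix n
  show "((1 - fps_const x * fps_X) * Abs_fps (\<lambda>n. x ^ n)) $ n = 1 $ n"
    by (cases n) (simp_all add: algebra_simps)
qed

text \<open>
  The exponent tuples are fibred over the exponent of the first variable. The resulting
  convolution is what makes the generating function gain one geometric series per variable.
\<close>

lemma complete_sym_Cons:
  "complete_sym n (x # w) = (\<Sum>i=0..n. x ^ i * complete_sym (n - i) w)"
proof -
  define M where "M s k = {m :: nat list. length m = s \<and> sum_list m = k}" for s k
  have "(\<Sum>i=0..n. x ^ i * complete_sym (n - i) w) =
      (\<Sum>(i, m)\<in>Sigma {0..n} (\<lambda>i. M (length w) (n - i)).
         x ^ i * (\<Prod>j<length w. w ! j ^ (m ! j)))"
    unfolding complete_sym_def M_def sum_distrib_left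
    by (rule sum.Sigma) (auto intro: finite_exponents)
  also have "\<dots> = (\<Sum>m\<in>M (length (x # w)) n. \<Prod>j<length (x # w). (x # w) ! j ^ (m ! j))"
    by (rule sum.reindex_bij_witness
        [where i = "\<lambda>m. (hd m, tl m)" and j = "\<lambda>(i, m). i # m"])
      (auto simp: M_def length_Suc_conv prod.lessThan_Suc_shift simp del: prod.lessThan_Suc)
  also have "\<dots> = complete_sym n (x # w)"
    by (simp add: complete_sym_def M_def)
  finally show ?thesis ..
qed

lemma complete_sym_generating_function:
  "Abs_fps (\<lambda>n. complete_sym n w) = inverse (linear_factors (-1) w)"
proof (induction w)
  case Nil
  have "{m :: nat list. m = [] \<and> n = 0} = (if n = 0 then {[]} else {})" for n :: nat
    by auto
  then show ?case
    by (auto simp: complete_sym_def fps_eq_iff cong: conj_cong)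
next
  case (Cons x w)
  have "Abs_fps (\<lambda>n. complete_sym n (x # w)) =
      Abs_fps (\<lambda>n. x ^ n) * Abs_fps (\<lambda>n. complete_sym n w)"
    by (simp add: fps_eq_iff complete_sym_Cons fps_mult_nth)
  also have "\<dots> = inverse (linear_factors (-1) (x # w))"
    by (simp add: Cons.IH geometric_fps fps_inverse_mult flip: fps_const_neg)
  finally show ?case .
qed

lemma power_sym_generating_function:
  "Abs_fps (\<lambda>n. power_sym n w) = (\<Sum>x\<leftarrow>w. inverse (1 - fps_const x * fps_X))"
proof -
  have "Abs_fps (\<lambda>n. power_sym n w) = (\<Sum>x\<leftarrow>w. Abs_fps (\<lambda>n. x ^ n))"
    by (simp add: fps_eq_iff power_sym_def sum_list_sum_nth fps_sum_nth atLeast0LessThan)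
  then show ?thesis
    by (simp add: geometric_fps)
qed

section \<open>Pairing a variable with its inverse\<close>

lemma paired_linear_factors:
  assumes "x \<noteq> 0" and "c ^ 2 = 1"
  shows "(1 + fps_const (c * x) * fps_X) * (1 + fps_const (c * inverse x) * fps_X) =
    one_plus_X2_powr 1 * (1 + fps_const (c * (x + inverse x)) * X_over_one_plus_X2)"
proof -
  have cx: "fps_const (c * x) * fps_const (c * inverse x) = 1"
    using assms by (simp add: power2_eq_square field_simps)
  have X: "one_plus_X2_powr 1 * X_over_one_plus_X2 = fps_X"
    by (simp add: X_over_one_plus_X2_def mult.left_commute flip: one_plus_X2_powr_add)
  have "(1 + fps_const (c * x) * fps_X) * (1 + fps_const (c * inverse x) * fps_X) =
      1 + (fps_const (c * x) + fps_const (c * inverse x)) * fps_X +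
      fps_const (c * x) * fps_const (c * inverse x) * fps_X ^ 2"
    by (simp add: algebra_simps power2_eq_square del: fps_const_mult fps_const_add)
  also have "\<dots> = one_plus_X2_powr 1 +
      fps_const (c * (x + inverse x)) * (one_plus_X2_powr 1 * X_over_one_plus_X2)"
    unfolding cx X by (simp add: one_plus_X2_powr_1 distrib_left)
  finally show ?thesis
    by (simp add: distrib_left mult_ac)
qed

lemma linear_factors_with_inverse:
  assumes "\<forall>x\<in>set z. x \<noteq> 0" and "c ^ 2 = 1"
  shows "linear_factors c (with_inverse z) =
    one_plus_X2_powr (of_nat (length z)) *
      (linear_factors c (plus_inverse z) oo X_over_one_plus_X2)"
  using assms(1)
proof (induction z)
  case Nil
  show ?case
    by (simp add: with_inverse_def plus_inverse_def)
next
  case (Cons x z)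
  then have "x \<noteq> 0"
    and IH: "linear_factors c (with_inverse z) = one_plus_X2_powr (of_nat (length z)) *
      (linear_factors c (plus_inverse z) oo X_over_one_plus_X2)"
    by simp_all
  have "linear_factors c (with_inverse (x # z)) =
      ((1 + fps_const (c * x) * fps_X) * (1 + fps_const (c * inverse x) * fps_X)) *
      linear_factors c (with_inverse z)"
    by (simp add: with_inverse_def linear_factors_append mult_ac)
  also have "\<dots> = one_plus_X2_powr (of_nat (length (x # z))) *
      (((1 + fps_const (c * (x + inverse x)) * fps_X) * linear_factors c (plus_inverse z))
        oo X_over_one_plus_X2)"
    unfolding paired_linear_factors [OF \<open>x \<noteq> 0\<close> assms(2)] IH
    by (simp add: fps_compose_mult_distrib fps_compose_add_distrib one_plus_X2_powr_add mult_ac)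
  finally show ?case
    by (simp add: plus_inverse_def)
qed

text \<open>
  With \<open>w = x + x\<^sup>-\<^sup>1\<close>, the sum of the two geometric series has numerator
  \<open>2 - w X\<close> over \<open>(1 + X\<^sup>2) (1 - w Y)\<close>. As \<open>X / (1 + X\<^sup>2) = Y\<close>, it equals
  \<open>(2 (1 + X\<^sup>2)\<^sup>-\<^sup>1 - w Y) / (1 - w Y)\<close>, and \<open>w Y / (1 - w Y) = (1 - w Y)\<^sup>-\<^sup>1 - 1\<close>.
\<close>

lemma paired_geometric_series:
  assumes "x \<noteq> 0"
  defines "G \<equiv> inverse (1 - fps_const (x + inverse x) * fps_X) oo X_over_one_plus_X2"
  shows "inverse (1 - fps_const x * fps_X) + inverse (1 - fps_const (inverse x) * fps_X) =
    2 * (one_plus_X2_powr (-1) * G) - G + 1"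
proof -
  define a where "a = 1 - fps_const x * fps_X"
  define b where "b = 1 - fps_const (inverse x) * fps_X"
  define wY where "wY = fps_const (x + inverse x) * X_over_one_plus_X2"
  define Q where "Q = one_plus_X2_powr (-1)"
  have ab: "a * b = one_plus_X2_powr 1 * (1 - wY)"
    using paired_linear_factors [OF assms(1), of "-1"]
    by (simp add: a_def b_def wY_def del: minus_add_distrib flip: fps_const_neg)
  have G: "G = inverse (1 - wY)"
    by (simp add: G_def wY_def fps_inverse_compose fps_compose_sub_distrib
        fps_compose_mult_distrib)
  have G_eq: "wY * G = G - 1"
    using inverse_mult_eq_1 [of "1 - wY"] by (simp add: G wY_def algebra_simps)
  have inverse_ab: "inverse a * inverse b = Q * G"
    unfolding fps_inverse_mult [symmetric] ab
    by (simp add: G Q_def fps_inverse_mult one_plus_X2_powr_minus)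
  have "a * inverse a = 1" "b * inverse b = 1"
    by (simp_all add: a_def b_def inverse_mult_eq_1')
  then have "inverse a + inverse b = (a + b) * (inverse a * inverse b)"
    by (simp add: algebra_simps)
  also have "\<dots> = 2 * (Q * G) - fps_const (x + inverse x) * (fps_X * Q) * G"
    unfolding inverse_ab by (simp add: a_def b_def algebra_simps flip: fps_const_add)
  also have "\<dots> = 2 * (Q * G) - wY * G"
    by (simp add: wY_def X_over_one_plus_X2_def Q_def)
  finally show ?thesis
    by (simp add: G_eq a_def b_def Q_def)
qed

lemma power_sym_with_inverse:
  assumes "\<forall>x\<in>set z. x \<noteq> 0"
  defines "P \<equiv> Abs_fps (\<lambda>n. power_sym n (plus_inverse z)) oo X_over_one_plus_X2"
  shows "Abs_fps (\<lambda>n. power_sym n (with_inverse z)) =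
    2 * (one_plus_X2_powr (-1) * P) - P + of_nat (length z)"
  using assms(1) unfolding P_def power_sym_generating_function
proof (induction z)
  case Nil
  show ?case
    by (simp add: with_inverse_def plus_inverse_def)
next
  case (Cons x z)
  define S where "S v = (\<Sum>y\<leftarrow>v. inverse (1 - fps_const y * fps_X))" for v :: "complex list"
  have "S (with_inverse (x # z)) =
      (inverse (1 - fps_const x * fps_X) + inverse (1 - fps_const (inverse x) * fps_X)) +
      S (with_inverse z)"
    by (simp add: S_def with_inverse_def)
  with Cons show ?case
    by (simp add: S_def [symmetric] paired_geometric_series)
      (simp add: S_def plus_inverse_def fps_compose_add_distrib algebra_simps)
qed

section \<open>The three expansions\<close>

lemma elem_sym_with_inverse:
  assumes "\<forall>x\<in>set z. x \<noteq> 0"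
  shows "elem_sym n (with_inverse z) =
    (\<Sum>k=0..n div 2. ibinom (int (length z) - int n + 2 * int k) k *
       elem_sym (n - 2 * k) (plus_inverse z))"
proof -
  have "Abs_fps (\<lambda>n. elem_sym n (with_inverse z)) =
      one_plus_X2_powr (of_int (int (length z))) *
      (Abs_fps (\<lambda>n. elem_sym n (plus_inverse z)) oo X_over_one_plus_X2)"
    using linear_factors_with_inverse [OF assms, of 1]
    by (simp add: elem_sym_generating_function)
  then have "Abs_fps (\<lambda>n. elem_sym n (with_inverse z)) $ n =
      (\<Sum>k=0..n div 2. ibinom (int (length z) - int n + 2 * int k) k *
         Abs_fps (\<lambda>n. elem_sym n (plus_inverse z)) $ (n - 2 * k))"
    by (simp only: fps_nth_substitution)
  then show ?thesis
    by simp
qed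

lemma complete_sym_with_inverse:
  assumes "\<forall>x\<in>set z. x \<noteq> 0"
  shows "complete_sym n (with_inverse z) =
    (\<Sum>k=0..n div 2. ibinom (- int (length z) - int n + 2 * int k) k *
       complete_sym (n - 2 * k) (plus_inverse z))"
proof -
  have "Abs_fps (\<lambda>n. complete_sym n (with_inverse z)) =
      one_plus_X2_powr (of_int (- int (length z))) *
      (Abs_fps (\<lambda>n. complete_sym n (plus_inverse z)) oo X_over_one_plus_X2)"
    using linear_factors_with_inverse [OF assms, of "-1"]
    by (simp add: complete_sym_generating_function fps_inverse_mult fps_inverse_compose
        one_plus_X2_powr_minus)
  then have "Abs_fps (\<lambda>n. complete_sym n (with_inverse z)) $ n =
      (\<Sum>k=0..n div 2. ibinom (- int (length z) - int n + 2 * int k) k *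
         Abs_fps (\<lambda>n. complete_sym n (plus_inverse z)) $ (n - 2 * k))"
    by (simp only: fps_nth_substitution)
  then show ?thesis
    by simp
qed

text \<open>
  The summand \<open>length z\<close> of the generating function only affects the constant
  coefficient, hence the restriction to positive \<open>n\<close>.
\<close>

lemma power_sym_with_inverse_nth:
  assumes "\<forall>x\<in>set z. x \<noteq> 0" and "n \<ge> 1"
  shows "power_sym n (with_inverse z) =
    2 * (\<Sum>k=0..n div 2. ibinom (2 * int k - int n - 1) k *
           power_sym (n - 2 * k) (plus_inverse z)) -
    (\<Sum>k=0..n div 2. ibinom (2 * int k - int n) k *
       power_sym (n - 2 * k) (plus_inverse z))"
proof -
  define F where "F = Abs_fps (\<lambda>n. power_sym n (plus_inverse z))"
  have "Abs_fps (\<lambda>n. power_sym n (with_inverse z)) =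
      fps_const 2 * (one_plus_X2_powr (of_int (-1)) * (F oo X_over_one_plus_X2)) -
      one_plus_X2_powr (of_int 0) * (F oo X_over_one_plus_X2) + fps_const (of_nat (length z))"
    using power_sym_with_inverse [OF assms(1)]
    by (simp add: F_def fps_of_nat numeral_fps_const)
  then have "Abs_fps (\<lambda>n. power_sym n (with_inverse z)) $ n =
      2 * (\<Sum>k=0..n div 2. ibinom (-1 - int n + 2 * int k) k * F $ (n - 2 * k)) -
      (\<Sum>k=0..n div 2. ibinom (0 - int n + 2 * int k) k * F $ (n - 2 * k))"
    using assms(2)
    by (simp only: fps_add_nth fps_sub_nth fps_mult_left_const_nth fps_nth_substitution) simp
  then show ?thesis
    by (simp add: F_def algebra_simps)
qed

lemma ibinom_negated_upper:
  "ibinom (- a) k = (-1) ^ k * ibinom (a + int k - 1) k"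
  using gbinomial_minus [of "of_int a :: complex" k] by (simp add: ibinom_def)

theorem theorem2:
  fixes r :: nat and z :: "complex list"
  assumes "r \<ge> 1" and "length z = r" and "\<forall>x \<in> set z. x \<noteq> 0"
  shows "(\<forall>n \<le> 2 * r. elem_sym n (with_inverse z) =
            (\<Sum>k = nat (max \<lfloor>(real n - real r) / 2\<rfloor> 0)..n div 2.
               ibinom (int r - int n + 2 * int k) k * elem_sym (n - 2 * k) (plus_inverse z)))
       \<and> (\<forall>n. complete_sym n (with_inverse z) =
            (\<Sum>k = 0..n div 2.
               (-1) ^ k * ibinom (int n - int k + int r - 1) k *
               complete_sym (n - 2 * k) (plus_inverse z)))
       \<and> (\<forall>n \<ge> 1. power_sym n (with_inverse z) =
            2 * (\<Sum>k = 0..(n + 1) div 2.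
                   if n < 2 * k then 0
                   else ibinom (2 * int k - int n - 1) k * power_sym (n - 2 * k) (plus_inverse z))
            - (\<Sum>k = 0..n div 2.
                 ibinom (2 * int k - int n) k * power_sym (n - 2 * k) (plus_inverse z)))"
proof (intro conjI allI impI)
  fix n
  \<comment> \<open>Below the stated lower limit of summation, the degree \<open>n - 2 k\<close> exceeds \<open>r\<close>.\<close>
  have vanish: "elem_sym (n - 2 * k) (plus_inverse z) = 0"
    if "k < nat (max \<lfloor>(real n - real r) / 2\<rfloor> 0)" for k
  proof (rule elem_sym_eq_0)
    have "int k + 1 \<le> \<lfloor>(real n - real r) / 2\<rfloor>"
      using that by linarith
    then have "real k + 1 \<le> (real n - real r) / 2"
      by (simp add: le_floor_iff)
    then show "length (plus_inverse z) < n - 2 * k"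
      using assms(2) by (simp add: plus_inverse_def)
  qed
  show "elem_sym n (with_inverse z) =
      (\<Sum>k = nat (max \<lfloor>(real n - real r) / 2\<rfloor> 0)..n div 2.
         ibinom (int r - int n + 2 * int k) k * elem_sym (n - 2 * k) (plus_inverse z))"
    unfolding elem_sym_with_inverse [OF assms(3)] assms(2)
    by (rule sum.mono_neutral_right) (auto simp: vanish)
next
  fix n
  have "ibinom (- int r - int n + 2 * int k) k =
      (-1) ^ k * ibinom (int n - int k + int r - 1) k" for k
    using ibinom_negated_upper [of "int r + int n - 2 * int k" k] by (simp add: algebra_simps)
  then show "complete_sym n (with_inverse z) =
      (\<Sum>k = 0..n div 2. (-1) ^ k * ibinom (int n - int k + int r - 1) k *
         complete_sym (n - 2 * k) (plus_inverse z))"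
    unfolding complete_sym_with_inverse [OF assms(3)] assms(2) by simp
next
  fix n :: nat
  assume "n \<ge> 1"
  have "(\<Sum>k = 0..(n + 1) div 2. if n < 2 * k then 0
           else ibinom (2 * int k - int n - 1) k * power_sym (n - 2 * k) (plus_inverse z)) =
      (\<Sum>k = 0..n div 2.
         ibinom (2 * int k - int n - 1) k * power_sym (n - 2 * k) (plus_inverse z))"
    by (rule sum.mono_neutral_cong_right) auto
  then show "power_sym n (with_inverse z) =
      2 * (\<Sum>k = 0..(n + 1) div 2. if n < 2 * k then 0
             else ibinom (2 * int k - int n - 1) k * power_sym (n - 2 * k) (plus_inverse z))
      - (\<Sum>k = 0..n div 2.
           ibinom (2 * int k - int n) k * power_sym (n - 2 * k) (plus_inverse z))"
    using power_sym_with_inverse_nth [OF assms(3) \<open>n \<ge> 1\<close>] by simp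
qed

end
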